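(* Let $\Lambda$ be a controllable linear system over $\mathbb{R}$ with flat output ${\bf y}=\{y_1,\dots,y_m\}$, and let $\mathcal{L}(y_1,\dot y_1,\dots,y_1^{(\mu_1)},\dots,y_m,\dot y_m,\dots,y_m^{(\mu_m)})\in S(\Lambda)$ be a Lagrangian. If $\mathcal{L}$ is of degree $2$, then the Euler-Lagrange system $$\frac{\partial \mathcal{L}}{\partial y_\iota}-\frac{d}{dt}\frac{\partial\mathcal{L}}{\partial\dot y_\iota}+\dots+(-1)^{\mu_\iota}\frac{d^{\mu_\iota}}{dt^{\mu_\iota}}\frac{\partial\mathcal{L}}{\partial y_\iota^{(\mu_\iota)}}=0,\qquad \iota=1,\dots,m,$$ is a system of (not necessarily homogeneous) linear ordinary differential equations in $y_1,\dots,y_m$ with constant coefficients in $\mathbb{R}$.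
   Context: A linear system over $\mathbb{R}$ is a finitely generated $\mathbb{R}[\frac{d}{dt}]$-module $\Lambda$, where $\mathbb{R}[\frac{d}{dt}]$ is the (polynomial) ring of linear differential operators with constant coefficients. It is controllable if it is a free module; a flat output is a basis of this free module. A Lagrangian is an element of the symmetric algebra $S(\Lambda)=\bigoplus_{\nu\ge0}S^\nu(\Lambda)$ of $\Lambda$ over $\mathbb{R}$ (as a real vector space), equipped with the derivation $\frac{d}{dt}$ extending that of $\Lambda$ and vanishing on $\mathbb{R}$. If ${\bf y}$ is a flat output, $S(\Lambda)$ is the polynomial ring $\mathbb{R}[y_\iota^{(\nu)}\mid 1\le\iota\le m,\ \nu\ge0]$ in infinitely many variables, with derivation $\frac{d}{dt}y_\iota^{(\nu)}=y_\iota^{(\nu+1)}$. The degree of $\mathcal{L}$ is the minimal $d$ such that $\mathcal{L}\in\bigoplus_{\nu\le d}S^\nu(\Lambda)$. *)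

theory Defs
  imports "HOL-Library.Poly_Mapping" "HOL-Computational_Algebra.Polynomial" Complex_Main
begin

section \<open>The symmetric algebra of a real vector space\<close>

text \<open>
  The symmetric algebra of a real vector space \<open>V\<close> is the quotient of the polynomial ring
  with one indeterminate \<open>sym_var v\<close> for each \<open>v \<in> V\<close> by the ideal generated by the
  relations expressing that \<open>v \<mapsto> sym_var v\<close> is linear.
  Polynomials are finitely supported maps from monomials to coefficients.
\<close>

definition sym_var :: "'v \<Rightarrow> ('v \<Rightarrow>\<^sub>0 nat) \<Rightarrow>\<^sub>0 real"
  where "sym_var v = Poly_Mapping.single (Poly_Mapping.single v 1) 1"

definition sym_const :: "real \<Rightarrow> ('v \<Rightarrow>\<^sub>0 nat) \<Rightarrow>\<^sub>0 real"
  where "sym_const r = Poly_Mapping.single 0 r"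

definition sym_relations :: "(('v::real_vector \<Rightarrow>\<^sub>0 nat) \<Rightarrow>\<^sub>0 real) set"
  where "sym_relations =
    {sym_var (v + w) - sym_var v - sym_var w | v w. True} \<union>
    {sym_var (r *\<^sub>R v) - sym_const r * sym_var v | r v. True}"

definition sym_ideal :: "(('v::real_vector \<Rightarrow>\<^sub>0 nat) \<Rightarrow>\<^sub>0 real) set"
  where "sym_ideal = module.span (*) sym_relations"

lemma module_mult: "module ((*) :: 'a::comm_ring_1 \<Rightarrow> 'a \<Rightarrow> 'a)"
  by unfold_locales (auto simp: algebra_simps)

lemma sym_ideal_0: "0 \<in> sym_ideal"
  unfolding sym_ideal_def by (rule module.span_zero[OF module_mult])

lemma sym_ideal_add: "p \<in> sym_ideal \<Longrightarrow> q \<in> sym_ideal \<Longrightarrow> p + q \<in> sym_ideal"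
  unfolding sym_ideal_def by (rule module.span_add[OF module_mult])

lemma sym_ideal_uminus: "p \<in> sym_ideal \<Longrightarrow> - p \<in> sym_ideal"
  unfolding sym_ideal_def by (rule module.span_neg[OF module_mult])

lemma sym_ideal_mult: "p \<in> sym_ideal \<Longrightarrow> q * p \<in> sym_ideal"
  unfolding sym_ideal_def by (rule module.span_scale[OF module_mult])

lemma sym_ideal_relation: "p \<in> sym_relations \<Longrightarrow> p \<in> sym_ideal"
  unfolding sym_ideal_def by (rule module.span_base[OF module_mult])

lemma sym_ideal_induct [consumes 1, case_names zero step]:
  assumes "p \<in> sym_ideal" and "P 0"
    and "\<And>a g p. g \<in> sym_relations \<Longrightarrow> P p \<Longrightarrow> P (a * g + p)"
  shows "P p"
  using assms(1) unfolding sym_ideal_def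
  by (rule module.span_induct_alt[OF module_mult]) (use assms(2,3) in auto)

lemma poly_mapping_add_induct [case_names single add]:
  fixes p :: "'a \<Rightarrow>\<^sub>0 'b::comm_monoid_add"
  assumes single: "\<And>m c. P (Poly_Mapping.single m c)"
    and add: "\<And>p q. P p \<Longrightarrow> P q \<Longrightarrow> P (p + q)"
  shows "P p"
proof (induction p rule: update_induct)
  case const
  show ?case using single[of undefined 0] by simp
next
  case (update p m c)
  have "Poly_Mapping.update m c p = p + Poly_Mapping.single m c"
    by (rule poly_mapping_eqI)
      (use update in \<open>auto simp: lookup_update lookup_add lookup_single when_def in_keys_iff\<close>)
  with update single add show ?case by metis
qed

lemma sym_const_coeff_mult:
  fixes p q :: "('v \<Rightarrow>\<^sub>0 nat) \<Rightarrow>\<^sub>0 real"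
  shows "Poly_Mapping.lookup (p * q) 0 = Poly_Mapping.lookup p 0 * Poly_Mapping.lookup q 0"
proof (induction p rule: poly_mapping_add_induct)
  case (single m c)
  show ?case
  proof (induction q rule: poly_mapping_add_induct)
    case (single n d)
    have "m + n = 0 \<longleftrightarrow> m = 0 \<and> n = 0"
      by (auto simp: poly_mapping_eq_iff fun_eq_iff lookup_add)
    then show ?case
      by (auto simp: mult_single lookup_single when_def)
  next
    case (add p q)
    then show ?case by (simp add: lookup_add algebra_simps)
  qed
next
  case (add p q)
  then show ?case by (simp add: lookup_add algebra_simps)
qed

lemma sym_ideal_const_coeff: "p \<in> sym_ideal \<Longrightarrow> Poly_Mapping.lookup p 0 = 0"
proof (induction rule: sym_ideal_induct)
  case (step a g p)
  have "Poly_Mapping.lookup (sym_var v) 0 = 0" for v :: 'a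
    by (simp add: sym_var_def lookup_single when_def poly_mapping_eq_iff fun_eq_iff)
  with step show ?case
    by (auto simp: sym_relations_def lookup_add lookup_minus sym_const_coeff_mult)
qed simp

quotient_type (overloaded) 'v sym_alg =
  "('v::real_vector \<Rightarrow>\<^sub>0 nat) \<Rightarrow>\<^sub>0 real" / "\<lambda>p q. p - q \<in> sym_ideal"
proof (rule equivpI)
  show "reflp (\<lambda>p q :: ('v \<Rightarrow>\<^sub>0 nat) \<Rightarrow>\<^sub>0 real. p - q \<in> sym_ideal)"
    by (simp add: reflp_def sym_ideal_0)
  show "symp (\<lambda>p q :: ('v \<Rightarrow>\<^sub>0 nat) \<Rightarrow>\<^sub>0 real. p - q \<in> sym_ideal)"
    unfolding symp_def by (metis minus_diff_eq sym_ideal_uminus)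
  show "transp (\<lambda>p q :: ('v \<Rightarrow>\<^sub>0 nat) \<Rightarrow>\<^sub>0 real. p - q \<in> sym_ideal)"
    unfolding transp_def
  proof (intro allI impI)
    fix p q r :: "('v \<Rightarrow>\<^sub>0 nat) \<Rightarrow>\<^sub>0 real"
    assume "p - q \<in> sym_ideal" "q - r \<in> sym_ideal"
    then have "(p - q) + (q - r) \<in> sym_ideal" by (rule sym_ideal_add)
    then show "p - r \<in> sym_ideal" by simp
  qed
qed

instantiation sym_alg :: (real_vector) comm_ring_1
begin

lift_definition zero_sym_alg :: "'a sym_alg" is 0 .

lift_definition one_sym_alg :: "'a sym_alg" is 1 .

lift_definition plus_sym_alg :: "'a sym_alg \<Rightarrow> 'a sym_alg \<Rightarrow> 'a sym_alg" is "(+)"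
  using sym_ideal_add by (fastforce simp: algebra_simps)

lift_definition uminus_sym_alg :: "'a sym_alg \<Rightarrow> 'a sym_alg" is uminus
  using sym_ideal_uminus by fastforce

lift_definition minus_sym_alg :: "'a sym_alg \<Rightarrow> 'a sym_alg \<Rightarrow> 'a sym_alg" is "(-)"
proof -
  fix p p' q q' :: "('a \<Rightarrow>\<^sub>0 nat) \<Rightarrow>\<^sub>0 real"
  assume "p - p' \<in> sym_ideal" "q - q' \<in> sym_ideal"
  then have "(p - p') + - (q - q') \<in> sym_ideal"
    by (intro sym_ideal_add sym_ideal_uminus)
  then show "p - q - (p' - q') \<in> sym_ideal" by (simp add: algebra_simps)
qed

lift_definition times_sym_alg :: "'a sym_alg \<Rightarrow> 'a sym_alg \<Rightarrow> 'a sym_alg" is "(*)"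
proof -
  fix p p' q q' :: "('a \<Rightarrow>\<^sub>0 nat) \<Rightarrow>\<^sub>0 real"
  assume "p - p' \<in> sym_ideal" "q - q' \<in> sym_ideal"
  then have "q * (p - p') + p' * (q - q') \<in> sym_ideal"
    by (intro sym_ideal_add sym_ideal_mult)
  then show "p * q - p' * q' \<in> sym_ideal" by (simp add: algebra_simps)
qed

instance
proof
  show "(0 :: 'a sym_alg) \<noteq> 1"
    by transfer (use sym_ideal_const_coeff in \<open>fastforce simp: lookup_minus\<close>)
qed (transfer; simp add: sym_ideal_0 algebra_simps)+

end

lemma sym_const_add: "sym_const (r + s) = sym_const r + sym_const s"
  by (simp add: sym_const_def single_add)

lemma sym_const_mult: "sym_const (r * s) = sym_const r * sym_const s"
  by (simp add: sym_const_def mult_single)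

lemma sym_const_1: "sym_const 1 = 1"
  by (simp add: sym_const_def)

instantiation sym_alg :: (real_vector) real_algebra_1
begin

lift_definition scaleR_sym_alg :: "real \<Rightarrow> 'a sym_alg \<Rightarrow> 'a sym_alg"
  is "\<lambda>r p. sym_const r * p"
  using sym_ideal_mult by (metis right_diff_distrib)

instance
  by standard
    (transfer; simp add: sym_ideal_0 sym_const_add sym_const_mult sym_const_1 algebra_simps)+

end

lift_definition sym_incl :: "'v::real_vector \<Rightarrow> 'v sym_alg" is sym_var .

lemma linear_sym_incl: "linear sym_incl"
proof
  fix v w :: 'a and r :: real
  have "sym_var (v + w) - (sym_var v + sym_var w) \<in> sym_ideal"
    by (rule sym_ideal_relation) (auto simp: sym_relations_def algebra_simps)
  then show "sym_incl (v + w) = sym_incl v + sym_incl w" by transfer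
  have "sym_var (r *\<^sub>R v) - sym_const r * sym_var v \<in> sym_ideal"
    by (rule sym_ideal_relation) (auto simp: sym_relations_def)
  then show "sym_incl (r *\<^sub>R v) = r *\<^sub>R sym_incl v" by transfer
qed

definition sym_power :: "nat \<Rightarrow> 'v::real_vector sym_alg set"
  where "sym_power n = span {prod_list (map sym_incl vs) | vs. length vs = n}"

definition sym_power_upto :: "nat \<Rightarrow> 'v::real_vector sym_alg set"
  where "sym_power_upto d = {\<Sum>n\<le>d. s n | s. \<forall>n\<le>d. s n \<in> sym_power n}"

definition sym_degree :: "'v::real_vector sym_alg \<Rightarrow> nat"
  where "sym_degree L = (LEAST d. L \<in> sym_power_upto d)"


section \<open>Derivations\<close>

definition derivation :: "('a::{comm_ring_1, real_algebra_1} \<Rightarrow> 'a) \<Rightarrow> bool"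
  where "derivation D \<longleftrightarrow>
    (\<forall>a b. D (a + b) = D a + D b) \<and>
    (\<forall>a b. D (a * b) = D a * b + a * D b) \<and>
    (\<forall>r. D (of_real r) = 0)"

inductive_set generated_subalgebra :: "'a::{comm_ring_1, real_algebra_1} set \<Rightarrow> 'a set"
  for G :: "'a set"
  where
    const: "of_real r \<in> generated_subalgebra G"
  | base: "a \<in> G \<Longrightarrow> a \<in> generated_subalgebra G"
  | add: "a \<in> generated_subalgebra G \<Longrightarrow> b \<in> generated_subalgebra G \<Longrightarrow> a + b \<in> generated_subalgebra G"
  | mult: "a \<in> generated_subalgebra G \<Longrightarrow> b \<in> generated_subalgebra G \<Longrightarrow> a * b \<in> generated_subalgebra G"

lemma derivation_linear:
  assumes "derivation D"
  shows "linear D"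
proof
  fix a b :: 'a and r :: real
  show "D (a + b) = D a + D b" using assms by (simp add: derivation_def)
  have "D (of_real r * a) = of_real r * D a" using assms by (simp add: derivation_def)
  then show "D (r *\<^sub>R a) = r *\<^sub>R D a" by (simp add: scaleR_conv_of_real)
qed

lemma derivation_eq_on_subalgebra:
  assumes "derivation D" "derivation E" "\<And>g. g \<in> G \<Longrightarrow> D g = E g"
    and "a \<in> generated_subalgebra G"
  shows "D a = E a"
  using assms(4) by induction (use assms(1-3) in \<open>auto simp: derivation_def\<close>)

lemma generated_subalgebra_power:
  "a \<in> generated_subalgebra G \<Longrightarrow> a ^ n \<in> generated_subalgebra G"
  by (induction n)
    (auto intro: generated_subalgebra.mult generated_subalgebra.const[of 1, simplified])

lemma sym_of_real: "(of_real r :: 'v::real_vector sym_alg) = abs_sym_alg (sym_const r)"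
  by (simp add: of_real_def scaleR_sym_alg.abs_eq one_sym_alg_def)

lemma sym_monomial_in_generated:
  fixes m :: "'v::real_vector \<Rightarrow>\<^sub>0 nat"
  shows "abs_sym_alg (Poly_Mapping.single m 1) \<in> generated_subalgebra (range sym_incl)"
proof (induction m rule: poly_mapping_add_induct)
  case (single v n)
  have "Poly_Mapping.single (Poly_Mapping.single v n) 1 = sym_var v ^ n"
  proof (induction n)
    case (Suc n)
    have "Poly_Mapping.single v (Suc n) = Poly_Mapping.single v 1 + Poly_Mapping.single v n"
      by (simp flip: single_add)
    then show ?case
      by (simp add: Suc[symmetric]) (simp add: sym_var_def mult_single)
  qed simp
  moreover have "abs_sym_alg (sym_var v ^ n) = sym_incl v ^ n"
    by (induction n)
      (simp_all add: one_sym_alg_def times_sym_alg.abs_eq[symmetric] sym_incl.abs_eq)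
  ultimately show ?case
    by (simp add: generated_subalgebra_power generated_subalgebra.base)
next
  case (add p q)
  have "abs_sym_alg (Poly_Mapping.single (p + q) 1) =
      abs_sym_alg (Poly_Mapping.single p 1) * abs_sym_alg (Poly_Mapping.single q 1)"
    by (simp add: times_sym_alg.abs_eq mult_single)
  with add show ?case by (auto intro: generated_subalgebra.mult)
qed

lemma generated_subalgebra_range_sym_incl:
  "generated_subalgebra (range sym_incl) = (UNIV :: 'v::real_vector sym_alg set)"
proof -
  have "abs_sym_alg p \<in> generated_subalgebra (range sym_incl)"
    for p :: "('v \<Rightarrow>\<^sub>0 nat) \<Rightarrow>\<^sub>0 real"
  proof (induction p rule: poly_mapping_add_induct)
    case (single m c)
    have "abs_sym_alg (Poly_Mapping.single m c) =
        of_real c * abs_sym_alg (Poly_Mapping.single m 1)"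
      by (simp add: sym_of_real times_sym_alg.abs_eq sym_const_def mult_single)
    then show ?case
      by (auto intro: generated_subalgebra.mult generated_subalgebra.const
          sym_monomial_in_generated)
  next
    case (add p q)
    then show ?case
      by (auto simp: plus_sym_alg.abs_eq[symmetric] intro: generated_subalgebra.add)
  qed
  then have "x \<in> generated_subalgebra (range sym_incl)" for x :: "'v sym_alg"
    by (induction x rule: sym_alg.abs_induct) auto
  then show ?thesis by blast
qed

lemma derivation_sym_ext:
  fixes D E :: "'v::real_vector sym_alg \<Rightarrow> 'v sym_alg"
  assumes "derivation D" "derivation E" "\<And>v. D (sym_incl v) = E (sym_incl v)"
  shows "D = E"
proof
  fix x :: "'v sym_alg"
  have "x \<in> generated_subalgebra (range sym_incl)"
    by (simp add: generated_subalgebra_range_sym_incl)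
  then show "D x = E x"
    by (rule derivation_eq_on_subalgebra[OF assms(1,2), rotated]) (use assms(3) in auto)
qed

context
  fixes f :: "'v::real_vector \<Rightarrow> 'v sym_alg"
begin

private definition mono_deriv :: "('v \<Rightarrow>\<^sub>0 nat) \<Rightarrow> 'v sym_alg"
  where "mono_deriv m = (\<Sum>v\<in>Poly_Mapping.keys m. of_nat (Poly_Mapping.lookup m v) * f v *
    abs_sym_alg (Poly_Mapping.single (m - Poly_Mapping.single v 1) 1))"

private definition poly_deriv :: "(('v \<Rightarrow>\<^sub>0 nat) \<Rightarrow>\<^sub>0 real) \<Rightarrow> 'v sym_alg"
  where "poly_deriv p = (\<Sum>m\<in>Poly_Mapping.keys p. Poly_Mapping.lookup p m *\<^sub>R mono_deriv m)"

private lemma mono_deriv_superset: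
  assumes "finite K" "Poly_Mapping.keys m \<subseteq> K"
  shows "mono_deriv m = (\<Sum>v\<in>K. of_nat (Poly_Mapping.lookup m v) * f v *
    abs_sym_alg (Poly_Mapping.single (m - Poly_Mapping.single v 1) 1))"
  unfolding mono_deriv_def using assms
  by (intro sum.mono_neutral_left) (auto simp: in_keys_iff)

private lemma poly_deriv_superset:
  assumes "finite K" "Poly_Mapping.keys p \<subseteq> K"
  shows "poly_deriv p = (\<Sum>m\<in>K. Poly_Mapping.lookup p m *\<^sub>R mono_deriv m)"
  unfolding poly_deriv_def using assms
  by (intro sum.mono_neutral_left) (auto simp: in_keys_iff)

private lemma poly_deriv_add: "poly_deriv (p + q) = poly_deriv p + poly_deriv q"
proof -
  let ?K = "Poly_Mapping.keys p \<union> Poly_Mapping.keys q"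
  have "Poly_Mapping.keys (p + q) \<subseteq> ?K" by (rule keys_add)
  then show ?thesis
    by (simp add: poly_deriv_superset[of ?K] lookup_add scaleR_add_left sum.distrib)
qed

private lemma poly_deriv_single: "poly_deriv (Poly_Mapping.single m c) = c *\<^sub>R mono_deriv m"
  by (subst poly_deriv_superset[of "{m}"]) auto

private lemma poly_deriv_diff: "poly_deriv (p - q) = poly_deriv p - poly_deriv q"
  using poly_deriv_add[of "p - q" q] by simp

private lemma mono_deriv_shift:
  "of_nat (Poly_Mapping.lookup m v) * f v *
     abs_sym_alg (Poly_Mapping.single (m + n - Poly_Mapping.single v 1) 1) =
   of_nat (Poly_Mapping.lookup m v) * f v *
     abs_sym_alg (Poly_Mapping.single (m - Poly_Mapping.single v 1) 1) *
     abs_sym_alg (Poly_Mapping.single n 1)"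
proof (cases "Poly_Mapping.lookup m v = 0")
  case False
  then have "m + n - Poly_Mapping.single v 1 = (m - Poly_Mapping.single v 1) + n"
    by (auto simp: poly_mapping_eq_iff fun_eq_iff lookup_add lookup_minus lookup_single when_def)
  then show ?thesis by (simp add: times_sym_alg.abs_eq mult_single mult.assoc)
qed simp

private lemma mono_deriv_add:
  "mono_deriv (m + n) = mono_deriv m * abs_sym_alg (Poly_Mapping.single n 1) +
     abs_sym_alg (Poly_Mapping.single m 1) * mono_deriv n"
proof -
  let ?K = "Poly_Mapping.keys m \<union> Poly_Mapping.keys n"
  have "Poly_Mapping.keys (m + n) \<subseteq> ?K" by (rule keys_add)
  then have "mono_deriv (m + n) =
      (\<Sum>v\<in>?K. of_nat (Poly_Mapping.lookup m v) * f v *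
        abs_sym_alg (Poly_Mapping.single (m + n - Poly_Mapping.single v 1) 1)) +
      (\<Sum>v\<in>?K. of_nat (Poly_Mapping.lookup n v) * f v *
        abs_sym_alg (Poly_Mapping.single (n + m - Poly_Mapping.single v 1) 1))"
    by (simp add: mono_deriv_superset[of ?K] lookup_add sum.distrib[symmetric]
        distrib_right add.commute[of n m])
  then show ?thesis
    unfolding mono_deriv_shift
    by (simp add: mono_deriv_superset[of ?K m] mono_deriv_superset[of ?K n]
        sum_distrib_left sum_distrib_right mult_ac)
qed

private lemma poly_deriv_mult:
  "poly_deriv (p * q) = poly_deriv p * abs_sym_alg q + abs_sym_alg p * poly_deriv q"
proof (induction p rule: poly_mapping_add_induct)
  case (single m c)
  show ?case
  proof (induction q rule: poly_mapping_add_induct)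
    case (single n d)
    have *: "abs_sym_alg (Poly_Mapping.single k e) =
        e *\<^sub>R abs_sym_alg (Poly_Mapping.single k 1)" for k :: "'v \<Rightarrow>\<^sub>0 nat" and e
      by (simp add: scaleR_sym_alg.abs_eq sym_const_def mult_single)
    show ?case
      by (simp add: mult_single poly_deriv_single mono_deriv_add *[of m c] *[of n d] algebra_simps)
  next
    case (add p q)
    then show ?case
      by (simp add: distrib_left poly_deriv_add plus_sym_alg.abs_eq[symmetric] algebra_simps)
  qed
next
  case (add p q)
  then show ?case
    by (simp add: distrib_right poly_deriv_add plus_sym_alg.abs_eq[symmetric] algebra_simps)
qed

private lemma poly_deriv_const: "poly_deriv (sym_const r) = 0"
  by (simp add: sym_const_def poly_deriv_single mono_deriv_def)

private lemma poly_deriv_var: "poly_deriv (sym_var v) = f v"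
  by (simp add: sym_var_def poly_deriv_single mono_deriv_def flip: one_sym_alg.abs_eq)

private lemma poly_deriv_ideal:
  assumes "linear f" "p \<in> sym_ideal"
  shows "poly_deriv p = 0"
  using assms(2)
proof (induction rule: sym_ideal_induct)
  case zero
  show ?case by (simp add: poly_deriv_def)
next
  case (step a g p)
  from step(1) have "g \<in> sym_ideal" by (rule sym_ideal_relation)
  then have "abs_sym_alg g = 0"
    by (simp add: zero_sym_alg_def sym_alg.abs_eq_iff)
  moreover have "poly_deriv g = 0"
    using step(1) assms(1) unfolding sym_relations_def
    by (auto simp: poly_deriv_diff poly_deriv_var poly_deriv_mult poly_deriv_const
        linear_add linear_scale sym_of_real[symmetric] scaleR_conv_of_real)
  ultimately show ?case using step(2) by (simp add: poly_deriv_add poly_deriv_mult)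
qed

lemma ex1_derivation_extending:
  assumes "linear f"
  shows "\<exists>!D. derivation D \<and> (\<forall>v. D (sym_incl v) = f v)"
proof (rule ex_ex1I)
  define D where "D x = poly_deriv (rep_sym_alg x)" for x
  have D: "D (abs_sym_alg p) = poly_deriv p" for p
  proof -
    have "rep_sym_alg (abs_sym_alg p) - p \<in> sym_ideal"
      using Quotient3_rep_abs[OF Quotient3_sym_alg] by (simp add: sym_ideal_0)
    then show ?thesis
      using poly_deriv_ideal[OF assms] by (metis D_def poly_deriv_diff right_minus_eq)
  qed
  have "derivation D"
    unfolding derivation_def
  proof (intro conjI allI)
    fix a b :: "'v sym_alg"
    show "D (a + b) = D a + D b"
      by (induction a rule: sym_alg.abs_induct, induction b rule: sym_alg.abs_induct) (simp add: plus_sym_alg.abs_eq D poly_deriv_add)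
    show "D (a * b) = D a * b + a * D b"
      by (induction a rule: sym_alg.abs_induct, induction b rule: sym_alg.abs_induct) (simp add: times_sym_alg.abs_eq D poly_deriv_mult)
    show "D (of_real r) = 0" for r
      by (simp add: sym_of_real D poly_deriv_const)
  qed
  moreover have "D (sym_incl v) = f v" for v
    by (simp add: sym_incl.abs_eq D poly_deriv_var)
  ultimately show "\<exists>D. derivation D \<and> (\<forall>v. D (sym_incl v) = f v)" by blast
next
  fix D E
  assume "derivation D \<and> (\<forall>v. D (sym_incl v) = f v)" "derivation E \<and> (\<forall>v. E (sym_incl v) = f v)"
  then show "D = E"
    using derivation_sym_ext[of D E] by simp
qed

end


section \<open>Linear systems and their Euler--Lagrange expressions\<close>

text \<open>
  The ring \<open>\<real>[d/dt]\<close> is \<^typ>\<open>real poly\<close>, the indeterminate \<open>[:0, 1:]\<close> being \<open>d/dt\<close>.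
  The real vector space structure of the module, which enters its symmetric algebra, is
  the one obtained by restricting scalars to the constant polynomials.
\<close>

locale linear_system = module scale
  for scale :: "real poly \<Rightarrow> 'l::real_vector \<Rightarrow> 'l" (infixr \<open>*s\<close> 75) +
  assumes scale_const: "[:r:] *s x = r *\<^sub>R x"
    and finitely_generated: "\<exists>B. finite B \<and> span B = UNIV"
begin

definition module_basis :: "'l set \<Rightarrow> bool"
  where "module_basis B \<longleftrightarrow> independent B \<and> span B = UNIV"

definition controllable :: bool
  where "controllable \<longleftrightarrow> (\<exists>B. module_basis B)"

definition flat_output :: "nat \<Rightarrow> (nat \<Rightarrow> 'l) \<Rightarrow> bool"
  where "flat_output m y \<longleftrightarrow> inj_on y {1..m} \<and> module_basis (y ` {1..m})"

text \<open>The element \<open>y\<^sub>i\<^sup>(\<^sup>k\<^sup>)\<close> of the symmetric algebra.\<close>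

definition jet :: "(nat \<Rightarrow> 'l) \<Rightarrow> nat \<Rightarrow> nat \<Rightarrow> 'l sym_alg"
  where "jet y i k = sym_incl ([:0, 1:] ^ k *s y i)"

definition time_deriv :: "'l sym_alg \<Rightarrow> 'l sym_alg"
  where "time_deriv = (THE D. derivation D \<and> (\<forall>x. D (sym_incl x) = sym_incl ([:0, 1:] *s x)))"

text \<open>
  For a flat output \<open>y\<close>, the symmetric algebra is the polynomial ring in the indeterminates
  \<open>y\<^sub>i\<^sup>(\<^sup>k\<^sup>)\<close>, so the partial derivative is the derivation with the prescribed values on these.
\<close>

definition partial_deriv :: "nat \<Rightarrow> (nat \<Rightarrow> 'l) \<Rightarrow> nat \<Rightarrow> nat \<Rightarrow> 'l sym_alg \<Rightarrow> 'l sym_alg"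
  where "partial_deriv m y i k = (THE D. derivation D \<and>
    (\<forall>j\<in>{1..m}. \<forall>l. D (jet y j l) = (if j = i \<and> l = k then 1 else 0)))"

definition euler_lagrange ::
    "nat \<Rightarrow> (nat \<Rightarrow> 'l) \<Rightarrow> (nat \<Rightarrow> nat) \<Rightarrow> 'l sym_alg \<Rightarrow> nat \<Rightarrow> 'l sym_alg"
  where "euler_lagrange m y \<mu> L i =
    (\<Sum>k\<le>\<mu> i. (- 1) ^ k * (time_deriv ^^ k) (partial_deriv m y i k L))"

text \<open>
  The system \<open>E 1 = 0, \<dots>, E m = 0\<close> consists of linear, possibly inhomogeneous, differential
  equations in \<open>y\<^sub>1, \<dots>, y\<^sub>m\<close> with constant real coefficients.
\<close>

definition linear_ode_system :: "nat \<Rightarrow> (nat \<Rightarrow> 'l) \<Rightarrow> (nat \<Rightarrow> 'l sym_alg) \<Rightarrow> bool"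
  where "linear_ode_system m y E \<longleftrightarrow>
    (\<exists>(n::nat) (a :: nat \<Rightarrow> nat \<Rightarrow> nat \<Rightarrow> real) (b :: nat \<Rightarrow> real). \<forall>i\<in>{1..m}.
      E i = (\<Sum>j=1..m. \<Sum>k\<le>n. a i j k *\<^sub>R jet y j k) + of_real (b i))"

lemma scale_scaleR: "p *s (r *\<^sub>R x) = r *\<^sub>R (p *s x)"
  using scale_left_commute[of p "[:r:]" x] by (simp only: scale_const)

lemma ex1_time_deriv:
  "\<exists>!D. derivation D \<and> (\<forall>x. D (sym_incl x) = sym_incl ([:0, 1:] *s x))"
proof (rule ex1_derivation_extending)
  show "linear (\<lambda>x. sym_incl ([:0, 1:] *s x))"
    by standard
      (simp_all add: scale_right_distrib scale_scaleR linear_add[OF linear_sym_incl]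
        linear_scale[OF linear_sym_incl])
qed

lemma scale_eq_sum_jets:
  "sym_incl (p *s y j) = (\<Sum>k\<le>degree p. coeff p k *\<^sub>R jet y j k)"
proof -
  have "[:coeff p k:] * [:0, 1:] ^ k = monom (coeff p k) k" for k
    by (simp add: monom_altdef)
  then have "(\<Sum>k\<le>degree p. [:coeff p k:] * [:0, 1:] ^ k) = p"
    by (simp only: poly_as_sum_of_monoms)
  then have "p *s y j = (\<Sum>k\<le>degree p. [:coeff p k:] * [:0, 1:] ^ k) *s y j"
    by (simp only:)
  also have "\<dots> = (\<Sum>k\<le>degree p. ([:coeff p k:] * [:0, 1:] ^ k) *s y j)"
    by (rule scale_sum_left)
  also have "\<dots> = (\<Sum>k\<le>degree p. coeff p k *\<^sub>R ([:0, 1:] ^ k *s y j))"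
    by (simp only: scale_scale[symmetric] scale_const)
  finally show ?thesis
    by (simp add: linear_sum[OF linear_sym_incl] linear_scale[OF linear_sym_incl] jet_def)
qed

lemma ex1_partial_deriv:
  assumes y: "flat_output m y" and i: "i \<in> {1..m}"
  shows "\<exists>!D. derivation D \<and>
    (\<forall>j\<in>{1..m}. \<forall>l. D (jet y j l) = (if j = i \<and> l = k then 1 else 0))"
proof (rule ex_ex1I)
  define B where "B = y ` {1..m}"
  from y have inj: "inj_on y {1..m}" and indep: "independent B" and span: "span B = UNIV"
    by (simp_all add: flat_output_def module_basis_def B_def)
  define f :: "'l \<Rightarrow> 'l sym_alg"
    where "f x = of_real (coeff (representation B x (y i)) k)" for x
  have "linear f"
  proof
    fix x x' :: 'l and r :: real
    show "f (x + x') = f x + f x'"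
      by (simp add: f_def representation_add[OF indep] span)
    have "representation B (r *\<^sub>R x) (y i) = [:r:] * representation B x (y i)"
      using representation_scale[OF indep, of x "[:r:]"] span
      by (simp only: scale_const) simp
    then show "f (r *\<^sub>R x) = r *\<^sub>R f x"
      by (simp add: f_def scaleR_conv_of_real)
  qed
  then obtain D where D: "derivation D" "\<And>x. D (sym_incl x) = f x"
    using ex1_implies_ex[OF ex1_derivation_extending] by blast
  have "D (jet y j l) = (if j = i \<and> l = k then 1 else 0)" if j: "j \<in> {1..m}" for j l
  proof -
    have "representation B ([:0, 1:] ^ l *s y j) (y i) =
        [:0, 1:] ^ l * (if y j = y i then 1 else 0)"
    proof -
      have "y j \<in> B" using j by (simp add: B_def)
      then show ?thesis
        using representation_scale[OF indep, of "y j" "[:0, 1:] ^ l"]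
        by (simp add: span representation_basis[OF indep])
    qed
    also have "\<dots> = (if j = i then monom 1 l else 0)"
      using inj_on_eq_iff[OF inj j i] by (simp add: monom_altdef)
    finally show ?thesis by (simp add: jet_def D f_def)
  qed
  with D show "\<exists>D. derivation D \<and>
      (\<forall>j\<in>{1..m}. \<forall>l. D (jet y j l) = (if j = i \<and> l = k then 1 else 0))"
    by (intro exI[of _ D] conjI ballI allI)
next
  fix D E
  assume "derivation D \<and> (\<forall>j\<in>{1..m}. \<forall>l. D (jet y j l) = (if j = i \<and> l = k then 1 else 0))"
    "derivation E \<and> (\<forall>j\<in>{1..m}. \<forall>l. E (jet y j l) = (if j = i \<and> l = k then 1 else 0))"
  then have D: "derivation D" and E: "derivation E"
    and eq: "\<And>j l. j \<in> {1..m} \<Longrightarrow> D (jet y j l) = E (jet y j l)" by simp_all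
  note linD = derivation_linear[OF D] and linE = derivation_linear[OF E]
  have "D (sym_incl x) = E (sym_incl x)" for x
  proof -
    have "x \<in> span (y ` {1..m})"
      using y by (simp add: flat_output_def module_basis_def)
    then show ?thesis
    proof (induction rule: span_induct_alt)
      case base
      show ?case by (simp add: linear_0[OF linear_sym_incl] linear_0[OF linD] linear_0[OF linE])
    next
      case (step p x z)
      then obtain j where "x = y j" "j \<in> {1..m}" by blast
      with step(2) show ?case
        by (simp add: linear_add[OF linear_sym_incl] scale_eq_sum_jets linear_add[OF linD]
            linear_add[OF linE] linear_sum[OF linD] linear_sum[OF linE] linear_scale[OF linD]
            linear_scale[OF linE] eq)
    qed
  qed
  then show "D = E"
    by (rule derivation_sym_ext[OF D E])
qed

end

end

theory Submission
  imports Defs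
begin

text \<open>
  Elements of degree at most \<open>1\<close> of the symmetric algebra form a subspace which is mapped into itself
  by \<open>d/dt\<close>. A partial derivative sends \<open>\<Lambda>\<close> into \<open>\<real>\<close>, so by the Leibniz rule it sends \<open>S\<^sup>\<nu>(\<Lambda>)\<close> with
  \<open>\<nu> \<le> 2\<close> into this subspace. Hence every Euler--Lagrange expression is a constant plus an element
  of \<open>\<Lambda>\<close>, and the latter is a real combination of the derivatives of the flat output.
\<close>

section \<open>Degrees in the symmetric algebra\<close>

lemma span_mult_closed:
  fixes S :: "'a::real_algebra set"
  assumes S: "\<And>a b. a \<in> S \<Longrightarrow> b \<in> S \<Longrightarrow> a * b \<in> S"
    and "a \<in> span S" "b \<in> span S"
  shows "a * b \<in> span S"
  using assms(2)
proof (induction rule: span_induct_alt)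
  case base
  show ?case by (simp add: span_zero)
next
  case (step c s z)
  \<comment> \<open>The left factor is now a single generator; a second induction expands
    \<open>b\<close>, leaving only products of two elements of \<open>S\<close>.\<close>
  have "s * b \<in> span S"
    using assms(3)
  proof (induction rule: span_induct_alt)
    case base
    show ?case by (simp add: span_zero)
  next
    case (step d t w)
    then show ?case
      using S[OF \<open>s \<in> S\<close>] by (simp add: distrib_left span_add span_scale span_base)
  qed
  with step show ?case by (simp add: distrib_right span_add span_scale)
qed

text \<open>The finite products contain 1 (empty list) and are closed under multiplication
  (concatenation), so their span is closed under every rule generating the subalgebra.\<close>

lemma generated_subalgebra_subset_span_prod_list:
  "generated_subalgebra G \<subseteq> span {prod_list as | as. set as \<subseteq> G}"
proof
  let ?P = "{prod_list as | as. set as \<subseteq> G}"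
  have 1: "1 \<in> span ?P"
    by (rule span_base) (auto intro: exI[of _ "[]"])
  fix a assume "a \<in> generated_subalgebra G"
  then show "a \<in> span ?P"
  proof induction
    case (const r)
    show ?case using span_scale[OF 1, of r] by (simp add: of_real_def)
  next
    case (base a)
    then show ?case by (intro span_base) (auto intro: exI[of _ "[a]"])
  next
    case (add a b)
    then show ?case by (simp add: span_add)
  next
    case (mult a b)
    have "a * b \<in> ?P" if "a \<in> ?P" "b \<in> ?P" for a b
    proof -
      from that obtain as bs where "a = prod_list as" "b = prod_list bs" "set as \<subseteq> G" "set bs \<subseteq> G"
        by blast
      then show ?thesis by (auto intro!: exI[of _ "as @ bs"])
    qed
    then show ?case using mult.IH by (rule span_mult_closed)
  qed
qed

lemma sym_power_subset_upto:
  assumes "n \<le> d"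
  shows "sym_power n \<subseteq> sym_power_upto d"
proof
  fix a :: "'a sym_alg" assume "a \<in> sym_power n"
  then show "a \<in> sym_power_upto d"
    unfolding sym_power_upto_def using assms
    \<comment> \<open>The decomposition is concentrated in degree \<open>n\<close>; the zero
      components lie in every \<open>sym_power\<close>.\<close>
    by (intro CollectI exI[of _ "\<lambda>k. if k = n then a else 0"])
      (auto simp: sym_power_def span_zero)
qed

lemma subspace_sym_power_upto: "subspace (sym_power_upto d)"
  unfolding subspace_def
proof (intro conjI ballI allI)
  show "0 \<in> sym_power_upto d"
    using sym_power_subset_upto[of 0 d] by (auto simp: sym_power_def span_zero)
next
  fix a b :: "'a sym_alg" assume "a \<in> sym_power_upto d" "b \<in> sym_power_upto d"
  then obtain s t where "a = (\<Sum>n\<le>d. s n)" "b = (\<Sum>n\<le>d. t n)"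
      "\<forall>n\<le>d. s n \<in> sym_power n" "\<forall>n\<le>d. t n \<in> sym_power n"
    unfolding sym_power_upto_def by blast
  then show "a + b \<in> sym_power_upto d"
    unfolding sym_power_upto_def
    by (intro CollectI exI[of _ "\<lambda>n. s n + t n"]) (auto simp: sum.distrib sym_power_def span_add)
next
  fix c and a :: "'a sym_alg" assume "a \<in> sym_power_upto d"
  then obtain s where "a = (\<Sum>n\<le>d. s n)" "\<forall>n\<le>d. s n \<in> sym_power n"
    unfolding sym_power_upto_def by blast
  then show "c *\<^sub>R a \<in> sym_power_upto d"
    unfolding sym_power_upto_def
    by (intro CollectI exI[of _ "\<lambda>n. c *\<^sub>R s n"])
      (auto simp: scaleR_sum_right sym_power_def span_scale)
qed

lemma sym_power_upto_mono:
  assumes "d \<le> e"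
  shows "sym_power_upto d \<subseteq> sym_power_upto e"
proof
  fix a :: "'a sym_alg" assume "a \<in> sym_power_upto d"
  then obtain s where s: "a = (\<Sum>n\<le>d. s n)" "\<forall>n\<le>d. s n \<in> sym_power n"
    unfolding sym_power_upto_def by blast
  show "a \<in> sym_power_upto e"
    unfolding s(1)
    by (rule subspace_sum[OF subspace_sym_power_upto])
      (use s(2) assms sym_power_subset_upto le_trans in blast)
qed

text \<open>Since \<open>sym_degree\<close> is a \<open>LEAST\<close>, it carries information about
  \<open>L\<close> only once some bound is known to exist. The elements of \<Lambda> generate the
  algebra, so \<open>L\<close> is a finite combination of products of them, and the longest product
  gives a bound.\<close>

lemma ex_sym_power_upto: "\<exists>d. L \<in> sym_power_upto d"
proof -
  have "L \<in> span {prod_list as | as. set as \<subseteq> range sym_incl}"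
    using generated_subalgebra_subset_span_prod_list[of "range sym_incl"]
    by (auto simp: generated_subalgebra_range_sym_incl)
  then show ?thesis
  proof (induction rule: span_induct_alt)
    case base
    show ?case using subspace_0[OF subspace_sym_power_upto] by blast
  next
    case (step c a z)
    then obtain as where "a = prod_list as" "set as \<subseteq> range sym_incl" by blast
    then obtain vs where vs: "a = prod_list (map sym_incl vs)"
      by (metis ex_map_conv subsetD rangeE)
    obtain d where d: "z \<in> sym_power_upto d" using step.IH by blast
    have "a \<in> sym_power (length vs)"
      unfolding sym_power_def using vs by (intro span_base) auto
    then have "a \<in> sym_power_upto (max d (length vs))"
      using sym_power_subset_upto[of "length vs" "max d (length vs)"] by auto
    moreover have "z \<in> sym_power_upto (max d (length vs))"
      using d sym_power_upto_mono[of d "max d (length vs)"] by auto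
    ultimately show ?case
      by (blast intro: subspace_add[OF subspace_sym_power_upto]
          subspace_scale[OF subspace_sym_power_upto])
  qed
qed

lemma sym_degree_mem: "L \<in> sym_power_upto (sym_degree L)"
  unfolding sym_degree_def by (rule LeastI_ex) (rule ex_sym_power_upto)

section \<open>Affine elements and derivations that are constant on generators\<close>

definition sym_affine :: "'v::real_vector sym_alg set"
  where "sym_affine = {of_real r + sym_incl v | r v. True}"

lemma of_real_in_sym_affine: "of_real r \<in> sym_affine"
  unfolding sym_affine_def
  using linear_0[OF linear_sym_incl] by (metis (mono_tags, lifting) CollectI add_0_right)

lemma sym_incl_in_sym_affine: "sym_incl v \<in> sym_affine"
  unfolding sym_affine_def by (metis (mono_tags, lifting) CollectI add_0_left of_real_0)

lemma subspace_sym_affine: "subspace sym_affine"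
  unfolding subspace_def
proof (intro conjI ballI allI)
  show "0 \<in> sym_affine" using of_real_in_sym_affine[of 0] by simp
next
  fix a b :: "'a sym_alg" assume "a \<in> sym_affine" "b \<in> sym_affine"
  then obtain r v s w where "a = of_real r + sym_incl v" "b = of_real s + sym_incl w"
    unfolding sym_affine_def by blast
  then have "a + b = of_real (r + s) + sym_incl (v + w)"
    by (simp add: linear_add[OF linear_sym_incl])
  then show "a + b \<in> sym_affine" unfolding sym_affine_def by blast
next
  fix c and a :: "'a sym_alg" assume "a \<in> sym_affine"
  then obtain r v where "a = of_real r + sym_incl v"
    unfolding sym_affine_def by blast
  then have "c *\<^sub>R a = of_real (c * r) + sym_incl (c *\<^sub>R v)"
    by (simp add: linear_scale[OF linear_sym_incl] scaleR_add_right of_real_def)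
  then show "c *\<^sub>R a \<in> sym_affine" unfolding sym_affine_def by blast
qed

text \<open>By linearity of \<open>D\<close> it suffices to treat products of at most two elements
  of \<Lambda>. On \<open>v * w\<close> with \<open>D v = r\<close> and \<open>D w = s\<close> the
  Leibniz rule gives \<open>r * w + s * v\<close>. The intended \<open>D\<close> is
  \<open>partial_deriv\<close>.\<close>

lemma derivation_sym_power_upto_2:
  assumes D: "derivation D" and const: "\<And>v. D (sym_incl v) \<in> range of_real"
    and L: "L \<in> sym_power_upto 2"
  shows "D L \<in> sym_affine"
proof -
  note lin = derivation_linear[OF D]
  have scaled: "of_real c * a \<in> sym_affine" if "a \<in> sym_affine" for c and a :: "'a sym_alg"
    using subspace_scale[OF subspace_sym_affine that, of c] by (simp add: scaleR_conv_of_real)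
  have prod: "D (prod_list (map sym_incl vs)) \<in> sym_affine" if "length vs \<le> 2" for vs
  proof -
    \<comment> \<open>The rule \<open>remdups_adj.cases\<close> serves only for its split into
      empty, singleton and longer lists; the length bound makes the last case a pair.\<close>
    from that consider "vs = []" | v where "vs = [v]" | v w where "vs = [v, w]"
      by (cases vs rule: remdups_adj.cases) auto
    then show ?thesis
    proof cases
      case 1
      have "D 1 = 0" using D unfolding derivation_def by (metis of_real_1)
      with 1 show ?thesis using of_real_in_sym_affine[of 0] by simp
    next
      case (2 v)
      then show ?thesis using const[of v] of_real_in_sym_affine by auto
    next
      case (3 v w)
      obtain r s where "D (sym_incl v) = of_real r" "D (sym_incl w) = of_real s"
        using const[of v] const[of w] by blast
      then have "D (prod_list (map sym_incl vs)) = of_real r * sym_incl w + of_real s * sym_incl v"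
        using D 3 by (simp add: derivation_def mult.commute)
      then show ?thesis
        by (simp add: subspace_add[OF subspace_sym_affine] scaled sym_incl_in_sym_affine)
    qed
  qed
  have power: "D a \<in> sym_affine" if "a \<in> sym_power n" "n \<le> 2" for a n
    using that(1) unfolding sym_power_def
  proof (induction rule: span_induct_alt)
    case base
    show ?case by (simp add: linear_0[OF lin] subspace_0[OF subspace_sym_affine])
  next
    case (step c a z)
    then have "D a \<in> sym_affine" using prod that(2) by auto
    with step.IH show ?case
      by (simp add: linear_add[OF lin] linear_scale[OF lin]
          subspace_add[OF subspace_sym_affine] subspace_scale[OF subspace_sym_affine])
  qed
  from L obtain s where "L = (\<Sum>n\<le>2. s n)" "\<forall>n\<le>2. s n \<in> sym_power n"
    unfolding sym_power_upto_def by blast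
  then show ?thesis
    by (auto simp: linear_sum[OF lin] intro!: subspace_sum[OF subspace_sym_affine] power)
qed

section \<open>Flat outputs and the Euler-Lagrange expressions\<close>

context linear_system
begin

lemma flat_output_expansion:
  assumes "flat_output m y"
  shows "\<exists>p. x = (\<Sum>j=1..m. p j *s y j)"
proof -
  have "inj_on y {1..m}" "x \<in> span (y ` {1..m})"
    using assms by (auto simp: flat_output_def module_basis_def)
  \<comment> \<open>Membership in the module span gives polynomial coefficients \<open>u\<close>
    indexed by basis elements; injectivity of \<open>y\<close> reindexes the sum, with
    \<open>p j = u (y j)\<close>.\<close>
  then show ?thesis
    by (auto simp: span_finite sum.reindex)
qed

text \<open>The coefficients \<open>a\<close> are those of the polynomials expanding
  \<open>x\<close> and vanish beyond their degrees, so the same \<open>a\<close> works for every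
  large \<open>N\<close>. This freedom lets several expansions share one order bound, as
  \<open>linear_ode_system\<close> demands.\<close>

lemma flat_output_jet_expansion:
  assumes "flat_output m y"
  shows "\<exists>n a. \<forall>N\<ge>n. sym_incl x = (\<Sum>j=1..m. \<Sum>k\<le>N. a j k *\<^sub>R jet y j k)"
proof -
  obtain p where p: "x = (\<Sum>j=1..m. p j *s y j)"
    using flat_output_expansion[OF assms] by blast
  have "sym_incl x = (\<Sum>j=1..m. \<Sum>k\<le>N. coeff (p j) k *\<^sub>R jet y j k)"
    \<comment> \<open>The sum of the degrees is a convenient upper bound for each of them.\<close>
    if N: "(\<Sum>j=1..m. degree (p j)) \<le> N" for N
  proof -
    have "(\<Sum>k\<le>degree (p j). coeff (p j) k *\<^sub>R jet y j k) = (\<Sum>k\<le>N. coeff (p j) k *\<^sub>R jet y j k)"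
      if "j \<in> {1..m}" for j
    proof (rule sum.mono_neutral_left)
      have "degree (p j) \<le> N"
        using member_le_sum[OF that, of "\<lambda>j. degree (p j)"] N by simp
      then show "{..degree (p j)} \<subseteq> {..N}" by simp
    qed (auto simp: coeff_eq_0 not_le)
    then show ?thesis
      by (simp add: p linear_sum[OF linear_sym_incl] scale_eq_sum_jets)
  qed
  then show ?thesis by (intro exI[of _ "\<Sum>j=1..m. degree (p j)"] exI[of _ "\<lambda>j k. coeff (p j) k"]) blast
qed

lemma derivation_time_deriv: "derivation time_deriv"
  and time_deriv_sym_incl: "time_deriv (sym_incl x) = sym_incl ([:0, 1:] *s x)"
  using theI'[OF ex1_time_deriv] by (simp_all add: time_deriv_def)

lemma time_deriv_sym_affine:
  assumes "a \<in> sym_affine"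
  shows "time_deriv a \<in> sym_affine"
proof -
  obtain r v where "a = of_real r + sym_incl v" using assms unfolding sym_affine_def by blast
  then have "time_deriv a = sym_incl ([:0, 1:] *s v)"
    using derivation_time_deriv by (simp add: derivation_def time_deriv_sym_incl)
  then show ?thesis by (simp add: sym_incl_in_sym_affine)
qed

lemma
  assumes "flat_output m y" "i \<in> {1..m}"
  shows derivation_partial_deriv: "derivation (partial_deriv m y i k)"
    and partial_deriv_jet:
      "j \<in> {1..m} \<Longrightarrow> partial_deriv m y i k (jet y j l) = (if j = i \<and> l = k then 1 else 0)"
  using theI'[OF ex1_partial_deriv[OF assms, of k]] unfolding partial_deriv_def by blast+

text \<open>The values of \<open>partial_deriv\<close> are prescribed on jets only, so the element
  is first expanded in jets. Linearity then leaves the coefficient at the jet \<open>(i, k)\<close>,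
  or 0 if that jet does not occur.\<close>

lemma partial_deriv_sym_incl:
  assumes y: "flat_output m y" and i: "i \<in> {1..m}"
  shows "partial_deriv m y i k (sym_incl x) \<in> range of_real"
proof -
  note lin = derivation_linear[OF derivation_partial_deriv[OF y i, of k]]
  obtain n a where "sym_incl x = (\<Sum>j=1..m. \<Sum>l\<le>n. a j l *\<^sub>R jet y j l)"
    using flat_output_jet_expansion[OF y] by blast
  then have "partial_deriv m y i k (sym_incl x) =
      (\<Sum>j=1..m. \<Sum>l\<le>n. a j l *\<^sub>R (if j = i \<and> l = k then 1 else 0))"
    by (simp add: linear_sum[OF lin] linear_scale[OF lin] partial_deriv_jet[OF y i])
  also have "\<dots> = of_real (\<Sum>j=1..m. \<Sum>l\<le>n. a j l * (if j = i \<and> l = k then 1 else 0))"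
    by (auto simp: of_real_def scaleR_sum_left intro!: sum.cong)
  finally show ?thesis by (rule range_eqI)
qed

lemma euler_lagrange_sym_affine:
  assumes "flat_output m y" "i \<in> {1..m}" "L \<in> sym_power_upto 2"
  shows "euler_lagrange m y \<mu> L i \<in> sym_affine"
  unfolding euler_lagrange_def
proof (rule Real_Vector_Spaces.subspace_sum[OF subspace_sym_affine])
  fix k
  have "partial_deriv m y i k L \<in> sym_affine"
    using assms by (intro derivation_sym_power_upto_2 derivation_partial_deriv partial_deriv_sym_incl)
  then have "(time_deriv ^^ l) (partial_deriv m y i k L) \<in> sym_affine" for l
    by (induction l) (auto intro: time_deriv_sym_affine)
  \<comment> \<open>The sign is first read as a real scalar, so that closure of a real subspace
    under scaling applies.\<close>
  then have "(- 1) ^ k *\<^sub>R (time_deriv ^^ k) (partial_deriv m y i k L) \<in> sym_affine"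
    by (rule Real_Vector_Spaces.subspace_scale[OF subspace_sym_affine])
  then show "(- 1) ^ k * (time_deriv ^^ k) (partial_deriv m y i k L) \<in> sym_affine"
    by (simp add: scaleR_conv_of_real)
qed

lemma linear_ode_system_sym_affine:
  assumes y: "flat_output m y" and E: "\<And>i. i \<in> {1..m} \<Longrightarrow> E i \<in> sym_affine"
  shows "linear_ode_system m y E"
proof -
  define P where "P i b n a \<longleftrightarrow>
    (\<forall>N\<ge>n. E i = (\<Sum>j=1..m. \<Sum>k\<le>N. a j k *\<^sub>R jet y j k) + of_real b)" for i b n a
  have "\<exists>b n a. P i b n a" if "i \<in> {1..m}" for i
  proof -
    \<comment> \<open>The scalar \<open>b\<close> becomes the inhomogeneous term, and the jet
      expansion of \<open>x\<close> the homogeneous part.\<close>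
    from E[OF that] obtain b x where "E i = of_real b + sym_incl x"
      unfolding sym_affine_def by blast
    moreover obtain n a where "\<forall>N\<ge>n. sym_incl x = (\<Sum>j=1..m. \<Sum>k\<le>N. a j k *\<^sub>R jet y j k)"
      using flat_output_jet_expansion[OF y, of x] by blast
    ultimately have "P i b n a" by (simp add: P_def add.commute)
    then show ?thesis by blast
  qed
  then obtain b n a where *: "\<And>i. i \<in> {1..m} \<Longrightarrow> P i (b i) (n i) (a i)"
    by metis
  \<comment> \<open>The sum of the individual thresholds is an order valid for all equations at
    once.\<close>
  have "n i \<le> (\<Sum>i=1..m. n i)" if "i \<in> {1..m}" for i
    using member_le_sum[OF that, of n] by simp
  with * show ?thesis
    unfolding linear_ode_system_def P_def
    by (intro exI[of _ "\<Sum>i=1..m. n i"] exI[of _ a] exI[of _ b]) blast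
qed

end

theorem proposition12:
  fixes scale :: "real poly \<Rightarrow> 'l::real_vector \<Rightarrow> 'l"
    and m :: nat and y :: "nat \<Rightarrow> 'l" and \<mu> :: "nat \<Rightarrow> nat" and L :: "'l sym_alg"
  assumes "linear_system scale"
    and "linear_system.controllable scale"
    and "linear_system.flat_output scale m y"
    and "L \<in> generated_subalgebra {linear_system.jet scale y i k | i k. i \<in> {1..m} \<and> k \<le> \<mu> i}"
    and "sym_degree L = 2"
  shows "linear_system.linear_ode_system scale m y (linear_system.euler_lagrange scale m y \<mu> L)"
proof -
  interpret linear_system scale by fact
  \<comment> \<open>The minimum defining the degree is attained, so degree 2 yields an actual
    decomposition into components of degree at most 2.\<close>
  have "L \<in> sym_power_upto 2" using sym_degree_mem[of L] assms(5) by simp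
  with assms(3) show ?thesis
    by (intro linear_ode_system_sym_affine euler_lagrange_sym_affine)
qed

end
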